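(* For every integer $r\ge1$, the number $\Lambda_{2r}$ of Hesse loops of length $2r$ is $$\Lambda_{2r}=\frac{1}{2r}\sum_{d\mid r}\mu\left(\frac{r}{d}\right)\Phi'_{2d},$$ where $\Phi'_{2d}=2\times 3^d-4$ and $\mu$ is the Möbius function.
   Context: For $c\in\mathbb{R}$ let $\Gamma_c:\ x^3+y^3+z^3+c\,xyz=0$ in $\mathbb{RP}^2$, and let $\Gamma_\infty:\ xyz=0$. The Hesse derivative of the cubic curve given by a homogeneous cubic $f$ is the curve $\mathcal{H}\Gamma_f:\ \det(H_f)=0$, where $H_f$ is the Hesse matrix (matrix of second partial derivatives) of $f$. On these curves the operator $\mathcal{H}$ acts by $\mathcal{H}\Gamma_c=\Gamma_{h(c)}$ with $h(c)=-\frac{108+c^3}{3c^2}$ for $c\in\mathbb{R}\setminus\{0\}$, $\mathcal{H}\Gamma_0=\Gamma_\infty$ and $\mathcal{H}\Gamma_\infty=\Gamma_\infty$. A Hesse loop is a closed orbit of this system starting at some $\Gamma_{c_0}$ with $c_0\in\mathbb{R}$, i.e. $\mathcal{H}^n\Gamma_{c_0}=\Gamma_{c_0}$ for some $n>0$; the minimal $n>0$ with this property is the length of the loop. A loop of length $n$ is counted once, as a periodic cycle consisting of $n$ curves (not once per starting curve). *)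

theory Defs
  imports "HOL-Analysis.Determinants" "HOL-Analysis.Derivative" "HOL-Computational_Algebra.Squarefree"
begin

definition partial_deriv :: "3 \<Rightarrow> (real^3 \<Rightarrow> real) \<Rightarrow> real^3 \<Rightarrow> real" where
  "partial_deriv i f v = deriv (\<lambda>t. f (v + t *\<^sub>R axis i 1)) 0"

definition hesse_matrix :: "(real^3 \<Rightarrow> real) \<Rightarrow> real^3 \<Rightarrow> real^3^3" where
  "hesse_matrix f v = (\<chi> i j. partial_deriv i (partial_deriv j f) v)"

definition hesse_det :: "(real^3 \<Rightarrow> real) \<Rightarrow> real^3 \<Rightarrow> real" where
  "hesse_det f v = det (hesse_matrix f v)"

text \<open>Points of the real projective plane are the one-dimensional subspaces of \<open>\<real>\<^sup>3\<close>.
  A form \<open>f\<close> is represented by its polynomial function on \<open>\<real>\<^sup>3\<close>.\<close>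

definition plane_curve :: "(real^3 \<Rightarrow> real) \<Rightarrow> (real^3) set set" where
  "plane_curve f = {L. subspace L \<and> dim L = 1 \<and> (\<forall>v\<in>L. f v = 0)}"

text \<open>The \<open>n\<close>-th iterated Hesse derivative of the curve given by \<open>f\<close>. For an arbitrary cubic the
  set of real points does not determine the equation, so the iteration acts on equations, whereas
  curves are compared as subsets of the projective plane.\<close>

definition hesse_iterate :: "nat \<Rightarrow> (real^3 \<Rightarrow> real) \<Rightarrow> (real^3) set set" where
  "hesse_iterate n f = plane_curve ((hesse_det ^^ n) f)"

definition pencil_form :: "real \<Rightarrow> real^3 \<Rightarrow> real" where
  "pencil_form c v = (v$1)^3 + (v$2)^3 + (v$3)^3 + c * (v$1) * (v$2) * (v$3)"

definition has_loop_length :: "real \<Rightarrow> nat \<Rightarrow> bool" where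
  "has_loop_length c n \<longleftrightarrow>
     n > 0 \<and> hesse_iterate n (pencil_form c) = plane_curve (pencil_form c) \<and>
     (\<forall>m. 0 < m \<and> m < n \<longrightarrow> hesse_iterate m (pencil_form c) \<noteq> plane_curve (pencil_form c))"

text \<open>A loop is identified with the set of curves it consists of, so that it does not depend on
  the choice of the starting curve.\<close>

definition hesse_loops :: "nat \<Rightarrow> (real^3) set set set set" where
  "hesse_loops n =
     {(\<lambda>k. hesse_iterate k (pencil_form c)) ` {..<n} | c. has_loop_length c n}"

definition moebius_mu :: "nat \<Rightarrow> int" where
  "moebius_mu n = (if squarefree n then (- 1) ^ card (prime_factors n) else 0)"

end

theory Submission
  imports Defs "HOL-Analysis.Interval_Integral" "HOL-Analysis.Complex_Transcendental"
begin

text \<open>On the parameter circle \<open>\<real> \<union> {\<infinity>}\<close> the map \<open>h(c) = - (108 + c\<^sup>3) / (3 c\<^sup>2)\<close> fixes \<open>-3\<close> and \<open>\<infinity>\<close>,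
  maps the arc \<open>A = {..<-3}\<close> bijectively onto \<open>B = {-3<..}\<close>, and maps \<open>B\<close> three-to-one to \<open>A\<close> and its end
  points. So every periodic point outside \<open>-3\<close> and \<open>\<infinity>\<close> alternates between the arcs and has even period, and it
  suffices to study \<open>h\<^sup>2\<close> on \<open>A\<close>. A primitive of \<open>1 / sqrt \<bar>x\<^sup>3 + 27\<bar>\<close>, scaled to
  identify \<open>A\<close> with \<open>{0<..<\<pi>}\<close>, turns \<open>h\<^sup>2\<close> into the piecewise linear map \<open>t \<mapsto> t'\<close> given by
  \<open>cos t' = cos (3 t)\<close>. Its \<open>d\<close>-th iterate has as fixed points the solutions of \<open>cos (3\<^sup>d t) = cos t\<close>,
  of which there are \<open>3\<^sup>d - 2\<close> in \<open>{0<..<\<pi>}\<close>. Moebius inversion then counts the cycles.\<close>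

subsection \<open>Moebius inversion and periodic points\<close>

lemma moebius_mu_prime_mult:
  assumes "prime p" "\<not> p dvd n" "n > 0"
  shows "moebius_mu (p * n) = - moebius_mu n"
proof -
  have cop: "coprime p n"
    using assms by (simp add: prime_imp_coprime)
  have sf: "squarefree (p * n) \<longleftrightarrow> squarefree n"
    using squarefree_mult_coprime[OF cop] squarefree_prime[OF assms(1)]
      squarefree_mono[of n "p * n"] by auto
  have pf: "prime_factors (p * n) = insert p (prime_factors n)"
    using assms by (simp add: prime_factors_product prime_gt_0_nat prime_prime_factors)
  have "p \<notin> prime_factors n"
    using assms by (auto simp: in_prime_factors_iff)
  then show ?thesis
    by (simp add: moebius_mu_def sf pf)
qed

text \<open>Fix a prime \<open>p\<close> dividing \<open>n\<close>. Divisors divisible by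
  \<open>p ^ 2\<close> contribute 0, and the remaining ones pair off as \<open>d\<close> and
  \<open>p * d\<close> with opposite values.\<close>

lemma sum_moebius_mu_divisors:
  assumes "n > 0"
  shows "(\<Sum>d | d dvd n. moebius_mu d) = (if n = 1 then 1 else 0)"
proof (cases "n = 1")
  case True
  then show ?thesis by (simp add: moebius_mu_def)
next
  case False
  then obtain p where p: "prime p" "p dvd n"
    using prime_factor_nat by blast
  let ?A = "{d. d dvd n \<and> \<not> p dvd d}" and ?B = "{d. d dvd n \<and> p dvd d \<and> \<not> p ^ 2 dvd d}"
  have fin: "finite {d. d dvd n}" using assms by simp
  have "(\<Sum>d | d dvd n. moebius_mu d) = (\<Sum>d\<in>?A \<union> ?B. moebius_mu d)"
  proof (rule sum.mono_neutral_right[OF fin], blast, rule ballI)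
    fix d assume "d \<in> {d. d dvd n} - (?A \<union> ?B)"
    then have "\<not> squarefree d"
      using p by (auto simp: squarefree_def dest!: spec[of _ p])
    then show "moebius_mu d = 0" by (simp add: moebius_mu_def)
  qed
  also have "\<dots> = (\<Sum>d\<in>?A. moebius_mu d) + (\<Sum>d\<in>?B. moebius_mu d)"
    by (rule sum.union_disjoint) (use fin in \<open>auto intro: finite_subset\<close>)
  also have "?B = (\<lambda>d. p * d) ` ?A"
  proof (intro equalityI subsetI)
    fix x assume x: "x \<in> ?B"
    then obtain d where "x = p * d" by auto
    with x show "x \<in> (\<lambda>d. p * d) ` ?A"
      using p by (auto simp: power2_eq_square intro: dvd_trans[of d "p * d"])
  next
    fix x assume "x \<in> (\<lambda>d. p * d) ` ?A"
    then obtain d where d: "x = p * d" "d dvd n" "\<not> p dvd d" by auto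
    have "coprime p d" using d p by (simp add: prime_imp_coprime)
    then show "x \<in> ?B"
      using p d prime_gt_0_nat[OF p(1)] by (auto simp: power2_eq_square intro: divides_mult)
  qed
  also have "(\<Sum>d\<in>(\<lambda>d. p * d) ` ?A. moebius_mu d) = (\<Sum>d\<in>?A. moebius_mu (p * d))"
    using p(1) by (subst sum.reindex) (auto simp: inj_on_def)
  also have "\<dots> = - (\<Sum>d\<in>?A. moebius_mu d)"
    unfolding sum_negf[symmetric]
    using p(1) dvd_pos_nat[OF assms] by (intro sum.cong) (simp_all add: moebius_mu_prime_mult)
  finally show ?thesis using False by simp
qed

lemma moebius_inversion:
  fixes f g :: "nat \<Rightarrow> real"
  assumes "n > 0" and "\<And>d. d dvd n \<Longrightarrow> f d = (\<Sum>e | e dvd d. g e)"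
  shows "g n = (\<Sum>d | d dvd n. real_of_int (moebius_mu (n div d)) * f d)"
proof -
  have fin: "finite {d. d dvd m}" if "m dvd n" for m
    using assms(1) that dvd_pos_nat by auto
  have "(\<Sum>d | d dvd n. real_of_int (moebius_mu (n div d)) * f d)
     = (\<Sum>d | d dvd n. \<Sum>e | e dvd d. real_of_int (moebius_mu (n div d)) * g e)"
    by (rule sum.cong) (auto simp: assms(2) sum_distrib_left)
  also have "\<dots> = (\<Sum>(d, e) \<in> (SIGMA d:{d. d dvd n}. {e. e dvd d}).
      real_of_int (moebius_mu (n div d)) * g e)"
    by (rule sum.Sigma) (auto simp: fin)
  \<comment> \<open>Exchange of summation: a pair \<open>d\<close>, \<open>e\<close> with
    \<open>e dvd d\<close> is recorded as \<open>e\<close> together with \<open>k = n div d\<close>,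
    which runs over the divisors of \<open>n div e\<close>. The inner sum over \<open>k\<close> then
    vanishes unless \<open>e = n\<close>.\<close>
  also have "\<dots> = (\<Sum>(e, k) \<in> (SIGMA e:{e. e dvd n}. {k. k dvd n div e}).
      real_of_int (moebius_mu k) * g e)"
  proof (rule sum.reindex_bij_witness[of _ "\<lambda>(e, k). (n div k, e)" "\<lambda>(d, e). (e, n div d)"], goal_cases)
    case (1 a) then show ?case using assms(1) by (auto elim!: dvdE)
  next
    case (2 a) then show ?case using assms(1) by (auto elim!: dvdE)
  next
    case (3 a) then show ?case using assms(1) by (auto elim!: dvdE)
  next
    case (4 a) then show ?case using assms(1) by (auto elim!: dvdE)
  next
    case (5 a) then show ?case by auto
  qed
  also have "\<dots> = (\<Sum>e | e dvd n. \<Sum>k | k dvd n div e. real_of_int (moebius_mu k) * g e)"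
    by (rule sum.Sigma[symmetric]) (auto simp: fin)
  also have "\<dots> = (\<Sum>e | e dvd n. if e = n then g e else 0)"
  proof (rule sum.cong, simp, goal_cases)
    case (1 e)
    then have "n div e > 0" "n div e = 1 \<longleftrightarrow> e = n"
      using assms(1) by (auto elim!: dvdE)
    then show ?case
      using sum_moebius_mu_divisors[of "n div e"]
      by (simp flip: sum_distrib_right of_int_sum)
  qed
  also have "\<dots> = g n"
    using assms(1) by simp
  finally show ?thesis by simp
qed

section \<open>Minimal periods and cycles of an arbitrary map\<close>

definition minimal_period :: "('a \<Rightarrow> 'a) \<Rightarrow> 'a \<Rightarrow> nat \<Rightarrow> bool" where
  "minimal_period f x n \<longleftrightarrow> n > 0 \<and> (f ^^ n) x = x \<and> (\<forall>m. 0 < m \<and> m < n \<longrightarrow> (f ^^ m) x \<noteq> x)"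

text \<open>Reducing \<open>m\<close> modulo \<open>n\<close> leaves an exponent below
  \<open>n\<close>, and by minimality this fixes \<open>x\<close> only if it is 0.\<close>

lemma minimal_period_funpow_eq_iff:
  assumes "minimal_period f x n"
  shows "(f ^^ m) x = x \<longleftrightarrow> n dvd m"
proof -
  have n: "n > 0" "(f ^^ n) x = x" "\<And>k. 0 < k \<Longrightarrow> k < n \<Longrightarrow> (f ^^ k) x \<noteq> x"
    using assms by (auto simp: minimal_period_def)
  have "(f ^^ m) x = (f ^^ (m mod n)) x"
    by (rule funpow_mod_eq[symmetric, OF n(2)])
  then show ?thesis
    using n(1) n(3)[of "m mod n"] by (cases "m mod n = 0") (auto simp: mod_eq_0_iff_dvd)
qed

text \<open>Describing a minimal period by the set of all return times lets periods of different
  points and of different maps be compared by divisibility alone.\<close>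

lemma minimal_period_iff:
  assumes "n > 0"
  shows "minimal_period f x n \<longleftrightarrow> (\<forall>m. (f ^^ m) x = x \<longleftrightarrow> n dvd m)"
proof
  assume "\<forall>m. (f ^^ m) x = x \<longleftrightarrow> n dvd m"
  then show "minimal_period f x n"
    using assms nat_dvd_not_less by (simp add: minimal_period_def)
qed (simp add: minimal_period_funpow_eq_iff)

lemma periodic_imp_minimal_period:
  assumes "n > 0" "(f ^^ n) x = x"
  obtains k where "minimal_period f x k" "k dvd n"
proof -
  define k where "k = (LEAST k. k > 0 \<and> (f ^^ k) x = x)"
  have "k > 0 \<and> (f ^^ k) x = x"
    unfolding k_def by (rule LeastI[of _ n]) (use assms in simp)
  moreover have "(f ^^ m) x \<noteq> x" if "0 < m" "m < k" for m
    using that not_less_Least[of m "\<lambda>k. k > 0 \<and> (f ^^ k) x = x"] by (simp add: k_def)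
  ultimately have "minimal_period f x k" by (simp add: minimal_period_def)
  then show ?thesis
    using that assms minimal_period_funpow_eq_iff by metis
qed

lemma funpow_funpow: "(f ^^ m) ((f ^^ k) x) = (f ^^ (m + k)) x" for f :: "'a \<Rightarrow> 'a"
  by (simp add: funpow_add)

lemma minimal_period_shift:
  assumes "minimal_period f x n"
  shows "minimal_period f ((f ^^ k) x) n"
proof -
  have n: "n > 0" "(f ^^ n) x = x" using assms by (auto simp: minimal_period_def)
  have "(f ^^ m) ((f ^^ k) x) = (f ^^ k) x \<longleftrightarrow> (f ^^ m) x = x" for m
  proof
    assume "(f ^^ m) ((f ^^ k) x) = (f ^^ k) x"
    \<comment> \<open>\<open>f\<close> may fail to be injective, so \<open>f ^^ k\<close> is
      cancelled by walking on: after \<open>k\<close> steps from \<open>x\<close>, another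
      \<open>n * k - k\<close> steps lead back to \<open>x\<close>.\<close>
    then have "(f ^^ (n * k - k)) ((f ^^ m) ((f ^^ k) x)) = (f ^^ (n * k - k)) ((f ^^ k) x)"
      by simp
    then have "(f ^^ ((n * k - k) + m + k)) x = (f ^^ ((n * k - k) + k)) x"
      unfolding funpow_add by simp
    moreover have "(n * k - k) + m + k = m + n * k" "(n * k - k) + k = n * k"
      using n(1) by (cases n; simp)+
    moreover have "(f ^^ (n * k)) x = x"
      using minimal_period_funpow_eq_iff[OF assms] by simp
    ultimately show "(f ^^ m) x = x" by (simp add: funpow_add)
  next
    assume "(f ^^ m) x = x"
    then show "(f ^^ m) ((f ^^ k) x) = (f ^^ k) x"
      by (metis add.commute comp_apply funpow_add)
  qed
  then show ?thesis
    using assms n(1) by (simp add: minimal_period_iff)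
qed

text \<open>The orbits of the points of minimal period \<open>n\<close> partition the set of these
  points into blocks of size \<open>n\<close>.\<close>

lemma card_cycles:
  assumes fin: "finite {x. minimal_period f x n}" and "n > 0"
  shows "finite {(\<lambda>k. (f ^^ k) x) ` {..<n} | x. minimal_period f x n}"
    and "n * card {(\<lambda>k. (f ^^ k) x) ` {..<n} | x. minimal_period f x n} =
      card {x. minimal_period f x n}"
proof -
  let ?P = "{x. minimal_period f x n}" and ?orb = "\<lambda>x. (\<lambda>k. (f ^^ k) x) ` {..<n}"
  have eq: "{?orb x | x. minimal_period f x n} = ?orb ` ?P" by blast
  show fin': "finite {?orb x | x. minimal_period f x n}"
    unfolding eq using fin by simp
  \<comment> \<open>With all iterates in place of the first \<open>n\<close>, orbits of two points
    can be compared without tracking indices modulo \<open>n\<close>.\<close>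
  have orb: "?orb x = range (\<lambda>k. (f ^^ k) x)" if "x \<in> ?P" for x
  proof -
    have "(f ^^ k) x \<in> ?orb x" for k
    proof -
      have "(f ^^ k) x = (f ^^ (k mod n)) x"
        using that by (simp add: funpow_mod_eq minimal_period_def)
      then show ?thesis using \<open>n > 0\<close> by auto
    qed
    then show ?thesis by auto
  qed
  have orb_eq: "?orb y = ?orb x" if x: "x \<in> ?P" and y: "y \<in> ?orb x" for x y
  proof -
    obtain k where k: "y = (f ^^ k) x" "k < n" using y by blast
    have y: "y \<in> ?P" using minimal_period_shift[of f x n k] x k by simp
    have "(f ^^ (n - k)) y = (f ^^ (n - k + k)) x"
      unfolding funpow_add k(1) by simp
    then have x_eq: "x = (f ^^ (n - k)) y"
      using x k(2) by (simp add: minimal_period_def)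
    have "(f ^^ i) y \<in> range (\<lambda>k. (f ^^ k) x)" for i
      unfolding k(1) funpow_funpow by (rule rangeI)
    moreover have "(f ^^ i) x \<in> range (\<lambda>k. (f ^^ k) y)" for i
      by (subst x_eq, unfold funpow_funpow) (rule rangeI)
    ultimately have "range (\<lambda>k. (f ^^ k) y) = range (\<lambda>k. (f ^^ k) x)"
      by blast
    then show ?thesis using orb[OF x] orb[OF y] by simp
  qed
  have "n * card (?orb ` ?P) = card (\<Union>(?orb ` ?P))"
  proof (rule card_partition)
    fix c assume "c \<in> ?orb ` ?P"
    then obtain x where x: "x \<in> ?P" "c = ?orb x" by (rule imageE)
    have "inj_on (\<lambda>k. (f ^^ k) x) {..<n}"
    proof (rule linorder_inj_onI)
      fix i j assume ij: "i < j" "i \<in> {..<n}" "j \<in> {..<n}"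
      have "(f ^^ (j - i)) ((f ^^ i) x) \<noteq> (f ^^ i) x"
        using minimal_period_shift[of f x n i] x(1) ij by (auto simp: minimal_period_def)
      moreover have "(f ^^ (j - i)) ((f ^^ i) x) = (f ^^ j) x"
        using ij by (simp add: funpow_funpow)
      ultimately show "(f ^^ i) x \<noteq> (f ^^ j) x" by simp
    qed auto
    then show "card c = n" unfolding x(2) by (simp add: card_image)
  next
    fix c1 c2 assume c: "c1 \<in> ?orb ` ?P" "c2 \<in> ?orb ` ?P" "c1 \<noteq> c2"
    then obtain x1 x2 where x: "x1 \<in> ?P" "c1 = ?orb x1" "x2 \<in> ?P" "c2 = ?orb x2"
      by (elim imageE) blast
    show "c1 \<inter> c2 = {}"
    proof (rule ccontr)
      assume "c1 \<inter> c2 \<noteq> {}"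
      then obtain y where y: "y \<in> ?orb x1" "y \<in> ?orb x2"
        unfolding x(2,4) ex_in_conv[symmetric] by (elim exE IntE)
      have "c1 = c2"
        unfolding x(2,4) using orb_eq[OF x(1) y(1)] orb_eq[OF x(3) y(2)] by (rule subst)
      with c(3) show False by contradiction
    qed
  next
    show "finite (?orb ` ?P)" using fin by (rule finite_imageI)
  next
    show "finite (\<Union>(?orb ` ?P))" using fin by (intro finite_UN_I) auto
  qed
  also have "\<Union>(?orb ` ?P) = ?P"
  proof (intro equalityI subsetI)
    fix y assume "y \<in> \<Union>(?orb ` ?P)"
    then obtain x k where "minimal_period f x n" "y = (f ^^ k) x" by blast
    then show "y \<in> ?P" using minimal_period_shift by simp
  next
    fix y assume "y \<in> ?P"
    moreover then have "y \<in> ?orb y" using \<open>n > 0\<close> by (intro image_eqI[of _ _ 0]) auto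
    ultimately show "y \<in> \<Union>(?orb ` ?P)" by blast
  qed
  finally show "n * card {?orb x | x. minimal_period f x n} = card ?P"
    unfolding eq .
qed

text \<open>A point fixed by \<open>f ^^ n\<close> has exactly one minimal period, a divisor of
  \<open>n\<close>. Sorting the points by it yields the divisor sum that Moebius inversion takes as
  input.\<close>

lemma card_periodic_points:
  assumes "n > 0" "finite {x \<in> S. (f ^^ n) x = x}"
  shows "card {x \<in> S. (f ^^ n) x = x} = (\<Sum>d | d dvd n. card {x \<in> S. minimal_period f x d})"
proof -
  have iff: "(f ^^ n) x = x \<longleftrightarrow> (\<exists>d. d dvd n \<and> minimal_period f x d)" for x
    using minimal_period_funpow_eq_iff[of f x _ n] periodic_imp_minimal_period[OF assms(1), of f x]
    by metis
  then have eq: "{x \<in> S. (f ^^ n) x = x} = (\<Union>d\<in>{d. d dvd n}. {x \<in> S. minimal_period f x d})"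
    by blast
  have "minimal_period f x d \<Longrightarrow> minimal_period f x e \<Longrightarrow> d = e" for x d e
    by (metis minimal_period_def minimal_period_funpow_eq_iff dvd_antisym)
  then show ?thesis
    using assms unfolding eq by (intro card_UN_disjoint) (auto simp: iff)
qed

subsection \<open>The action on the Hesse pencil\<close>

text \<open>The coefficients act as homogeneous coordinates on the pencil: the parameter is
  \<open>b / a\<close>, and \<open>a = 0\<close> is the curve at infinity. The family is closed
  under \<open>hesse_det\<close>, with no division involved.\<close>

definition cubic_form :: "real \<Rightarrow> real \<Rightarrow> real^3 \<Rightarrow> real" where
  "cubic_form a b v = a * ((v$1)^3 + (v$2)^3 + (v$3)^3) + b * (v$1) * (v$2) * (v$3)"

lemma pencil_form_eq_cubic_form: "pencil_form c = cubic_form 1 c"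
  by (simp add: fun_eq_iff pencil_form_def cubic_form_def)

lemma partial_deriv_eqI:
  assumes "\<And>v. ((\<lambda>t. f (v + t *\<^sub>R axis i 1)) has_real_derivative g v) (at 0)"
  shows "partial_deriv i f = g"
  using assms by (auto simp: fun_eq_iff partial_deriv_def intro: DERIV_imp_deriv)

lemma partial_deriv_cubic_form:
  "partial_deriv 1 (cubic_form a b) = (\<lambda>v. 3 * a * (v$1)^2 + b * (v$2) * (v$3))"
  "partial_deriv 2 (cubic_form a b) = (\<lambda>v. 3 * a * (v$2)^2 + b * (v$1) * (v$3))"
  "partial_deriv 3 (cubic_form a b) = (\<lambda>v. 3 * a * (v$3)^2 + b * (v$1) * (v$2))"
  by (rule partial_deriv_eqI; unfold cubic_form_def;
      auto intro!: derivative_eq_intros simp: axis_def algebra_simps)+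

text \<open>All first partial derivatives of \<open>cubic_form\<close> have this shape. Coinciding
  indices are covered because the three contributions add up.\<close>

lemma partial_deriv_quadratic:
  fixes i j k l :: 3
  shows "partial_deriv m (\<lambda>v. a * (v$i)^2 + b * (v$j) * (v$k)) =
    (\<lambda>v. (if m = i then 2 * a * (v$i) else 0)
      + (if m = j then b * (v$k) else 0) + (if m = k then b * (v$j) else 0))"
  by (rule partial_deriv_eqI)
    (auto intro!: derivative_eq_intros simp: axis_def algebra_simps)

text \<open>The Hesse matrix has diagonal entries \<open>6 * a * v$i\<close> and, off the diagonal,
  \<open>b\<close> times the remaining coordinate. For nonzero \<open>a\<close> and \<open>b\<close>
  the ratio of the new coefficients is \<open>- (108 + c^3) / (3 * c^2)\<close> at
  \<open>c = b / a\<close>.\<close>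

lemma hesse_det_cubic_form:
  "hesse_det (cubic_form a b) = cubic_form (- 6 * a * b^2) (216 * a^3 + 2 * b^3)"
proof
  fix v :: "real^3"
  show "hesse_det (cubic_form a b) v = cubic_form (- 6 * a * b^2) (216 * a^3 + 2 * b^3) v"
    unfolding hesse_det_def hesse_matrix_def det_3
    by (simp add: partial_deriv_cubic_form partial_deriv_quadratic)
      (simp add: cubic_form_def algebra_simps power2_eq_square power3_eq_cube)
qed

definition hesse_fun :: "real \<Rightarrow> real" where
  "hesse_fun c = - (108 + c^3) / (3 * c^2)"

text \<open>\<open>Some c\<close> stands for \<open>\<Gamma>\<^sub>c\<close> and \<open>None\<close> for \<open>\<Gamma>\<^sub>\<infinity>\<close>.\<close>

definition hesse_map :: "real option \<Rightarrow> real option" where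
  "hesse_map x = (case x of None \<Rightarrow> None
    | Some c \<Rightarrow> if c = 0 then None else Some (hesse_fun c))"

section \<open>The curves of the pencil as sets of real points\<close>

definition pencil_curve :: "real option \<Rightarrow> (real^3) set set" where
  "pencil_curve x = (case x of None \<Rightarrow> plane_curve (cubic_form 0 1)
    | Some c \<Rightarrow> plane_curve (pencil_form c))"

lemma cubic_form_scaleR: "cubic_form a b (t *\<^sub>R v) = t^3 * cubic_form a b v"
  by (simp add: cubic_form_def algebra_simps power3_eq_cube)

text \<open>By homogeneity, vanishing on a line through 0 can be tested at one spanning
  vector.\<close>

lemma span_in_plane_curve_cubic_form_iff:
  assumes "v \<noteq> 0"
  shows "span {v} \<in> plane_curve (cubic_form a b) \<longleftrightarrow> cubic_form a b v = 0"
proof -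
  have "dim (span {v}) = 1" using assms by (simp add: dim_singleton)
  moreover have "(\<forall>w\<in>span {v}. cubic_form a b w = 0) \<longleftrightarrow> cubic_form a b v = 0"
    by (auto simp: span_singleton cubic_form_scaleR dest: spec[of _ 1])
  ultimately show ?thesis
    by (simp add: plane_curve_def)
qed

lemma plane_curve_mult:
  "k \<noteq> 0 \<Longrightarrow> plane_curve (\<lambda>v. k * f v) = plane_curve f"
  by (simp add: plane_curve_def)

lemma plane_curve_cubic_form:
  assumes "a \<noteq> 0 \<or> b \<noteq> 0"
  shows "plane_curve (cubic_form a b) = pencil_curve (if a = 0 then None else Some (b / a))"
proof (cases "a = 0")
  case True
  then have "cubic_form a b = (\<lambda>v. b * cubic_form 0 1 v)"
    by (simp add: fun_eq_iff cubic_form_def)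
  with True assms show ?thesis by (simp add: pencil_curve_def plane_curve_mult)
next
  case False
  then have "cubic_form a b = (\<lambda>v. a * cubic_form 1 (b / a) v)"
    by (simp add: fun_eq_iff cubic_form_def field_simps)
  with False show ?thesis
    by (simp add: pencil_curve_def plane_curve_mult pencil_form_eq_cubic_form)
qed

text \<open>The induction follows the equation through its coefficients, which never vanish
  simultaneously. Their ratio therefore stays meaningful and moves by
  \<open>hesse_map\<close>.\<close>

lemma hesse_iterate_pencil_form:
  "hesse_iterate n (pencil_form c) = pencil_curve ((hesse_map ^^ n) (Some c))"
proof -
  have "\<exists>a b. (hesse_det ^^ n) (pencil_form c) = cubic_form a b \<and> (a \<noteq> 0 \<or> b \<noteq> 0) \<and>
      (hesse_map ^^ n) (Some c) = (if a = 0 then None else Some (b / a))"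
  proof (induction n)
    case 0
    show ?case
      by (intro exI[of _ 1] exI[of _ c]) (simp add: pencil_form_eq_cubic_form)
  next
    case (Suc n)
    then obtain a b where ab: "(hesse_det ^^ n) (pencil_form c) = cubic_form a b"
      "a \<noteq> 0 \<or> b \<noteq> 0" "(hesse_map ^^ n) (Some c) = (if a = 0 then None else Some (b / a))"
      by blast
    show ?case
    proof (intro exI conjI)
      show "(hesse_det ^^ Suc n) (pencil_form c) = cubic_form (- 6 * a * b^2) (216 * a^3 + 2 * b^3)"
        by (simp add: ab hesse_det_cubic_form)
      show "- 6 * a * b^2 \<noteq> 0 \<or> 216 * a^3 + 2 * b^3 \<noteq> 0"
        using ab(2) by auto
      show "(hesse_map ^^ Suc n) (Some c) = (if - 6 * a * b^2 = 0 then None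
          else Some ((216 * a^3 + 2 * b^3) / (- 6 * a * b^2)))"
        using ab(2) by (auto simp: ab(3) hesse_map_def hesse_fun_def field_simps power2_eq_square power3_eq_cube)
    qed
  qed
  then show ?thesis
    unfolding hesse_iterate_def using plane_curve_cubic_form by metis
qed

text \<open>The real points determine the parameter: \<open>[1, 0, 0]\<close> lies on the curve at
  infinity but on no other, and a point \<open>[1, 1, z]\<close> with \<open>z\<close> nonzero lies
  on the curve of \<open>Some c\<close> for only one \<open>c\<close>.\<close>

lemma inj_pencil_curve: "inj pencil_curve"
proof -
  have *: "pencil_curve (Some c) \<noteq> pencil_curve None" for c
  proof -
    have "(vector [1, 0, 0] :: real^3) \<noteq> 0"
      by (simp add: vec_eq_iff forall_3)
    then have "span {vector [1, 0, 0]} \<in> pencil_curve None"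
      "span {vector [1, 0, 0]} \<notin> pencil_curve (Some c)"
      by (simp_all add: pencil_curve_def pencil_form_eq_cubic_form span_in_plane_curve_cubic_form_iff)
        (simp_all add: cubic_form_def)
    then show ?thesis by metis
  qed
  have "c = d" if eq: "pencil_curve (Some c) = pencil_curve (Some d)" for c d
  proof -
    \<comment> \<open>\<open>M\<close> is chosen so that \<open>z^3 + c * z + 2\<close> is
      nonpositive at \<open>- M\<close> and nonnegative at \<open>M\<close>; the constant term 2
      keeps the resulting root away from 0.\<close>
    define M where "M = 2 + \<bar>c\<bar>"
    have "\<bar>c * M\<bar> = \<bar>c\<bar> * M" by (simp add: M_def abs_mult)
    moreover have "2 * 1 \<le> M * (M * M - \<bar>c\<bar>)"
    proof (rule mult_mono)
      have "2 * M \<le> M * M" unfolding M_def by (intro mult_right_mono) auto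
      then show "1 \<le> M * M - \<bar>c\<bar>" by (simp add: M_def)
    qed (auto simp: M_def)
    ultimately have "(- M)^3 + c * (- M) + 2 \<le> 0" "0 \<le> M^3 + c * M + 2"
      by (auto simp: power3_eq_cube algebra_simps abs_le_iff abs_if split: if_splits)
    then have "\<exists>z. - M \<le> z \<and> z \<le> M \<and> z^3 + c * z + 2 = 0"
      by (intro IVT') (auto intro!: continuous_intros simp: M_def)
    then obtain z where z: "z^3 + c * z + 2 = 0" by blast
    then have "z \<noteq> 0" by auto
    have "(vector [1, 1, z] :: real^3) \<noteq> 0"
      by (simp add: vec_eq_iff forall_3)
    then have iff: "span {vector [1, 1, z]} \<in> pencil_curve (Some e) \<longleftrightarrow> z^3 + e * z + 2 = 0" for e
      by (simp add: pencil_curve_def pencil_form_eq_cubic_form span_in_plane_curve_cubic_form_iff)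
        (simp add: cubic_form_def algebra_simps)
    have "z^3 + d * z + 2 = 0" using iff[of c] iff[of d] z eq by simp
    with z \<open>z \<noteq> 0\<close> show "c = d"
      by (metis add_left_cancel add_right_cancel mult_right_cancel)
  qed
  with * show ?thesis
    unfolding inj_def by (metis option.exhaust)
qed

lemma has_loop_length_iff:
  "has_loop_length c n \<longleftrightarrow> n > 0 \<and> (hesse_map ^^ n) (Some c) = Some c \<and>
    (\<forall>m. 0 < m \<and> m < n \<longrightarrow> (hesse_map ^^ m) (Some c) \<noteq> Some c)"
proof -
  have "hesse_iterate m (pencil_form c) = plane_curve (pencil_form c) \<longleftrightarrow>
      (hesse_map ^^ m) (Some c) = Some c" for m
    using inj_eq[OF inj_pencil_curve, of "(hesse_map ^^ m) (Some c)" "Some c"]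
    by (simp add: hesse_iterate_pencil_form pencil_curve_def)
  then show ?thesis by (simp add: has_loop_length_def)
qed

subsection \<open>The equation \<open>cos (n t) = cos t\<close>\<close>

text \<open>Equal cosines mean equal or opposite angles modulo \<open>2 * pi\<close>. Here the first
  case makes \<open>m * t\<close> a multiple of \<open>pi\<close>, the second
  \<open>(m + 1) * t\<close>.\<close>

lemma cos_odd_mult_eq_cos_iff:
  fixes m :: nat
  assumes "m > 0"
  shows "t \<in> {0<..<pi} \<and> cos (real (2 * m + 1) * t) = cos t \<longleftrightarrow>
    t \<in> (\<lambda>k. real k * pi / real m) ` {1..<m} \<union> (\<lambda>k. real k * pi / real (m + 1)) ` {1..<m+1}"
    (is "?L \<longleftrightarrow> ?R")
proof
  assume ?L
  then have t: "0 < t" "t < pi" "cos (real (2 * m + 1) * t) = cos t" by auto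
  have *: "t \<in> (\<lambda>k. real k * pi / real q) ` {1..<q}"
    if q: "q > 0" "real q * t = of_int i * pi" for q :: nat and i :: int
  proof -
    have t_eq: "t = of_int i * pi / real q" using q by (simp add: field_simps)
    have "0 < real_of_int i * pi" "real_of_int i * pi < real q * pi"
      using t(1,2) q by (auto simp flip: q(2))
    then have "0 < i" "i < int q" by (simp_all add: zero_less_mult_iff)
    then show ?thesis
      using t_eq by (intro image_eqI[of _ _ "nat i"]) auto
  qed
  obtain x where "x \<in> \<int>"
    "real (2 * m + 1) * t = t + 2 * x * pi \<or> real (2 * m + 1) * t = - t + 2 * x * pi"
    using t(3) by (auto simp: cos_eq)
  then obtain i :: int where
    "real (2 * m + 1) * t = t + 2 * of_int i * pi \<or> real (2 * m + 1) * t = - t + 2 * of_int i * pi"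
    by (auto elim: Ints_cases)
  then have "real m * t = of_int i * pi \<or> real (m + 1) * t = of_int i * pi"
    by (auto simp: algebra_simps)
  then show ?R
    using *[of m i] *[of "m + 1" i] assms by auto
next
  assume ?R
  then obtain q k :: nat where q: "t = real k * pi / real q" "0 < k" "k < q" "q = m \<or> q = m + 1"
  proof (elim UnE imageE)
    fix k assume "t = real k * pi / real m" "k \<in> {1..<m}"
    with that[of k m] show thesis by simp
  next
    fix k assume "t = real k * pi / real (m + 1)" "k \<in> {1..<m+1}"
    with that[of k "m + 1"] show thesis by simp
  qed
  then have "real k * pi < real q * pi" by simp
  with q have t: "t \<in> {0<..<pi}"
    by (simp add: pos_divide_less_eq mult.commute)
  have "real q * t = real k * pi" using q by simp
  then have "real m * t = real k * pi \<or> real (m + 1) * t = real k * pi"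
    using q(4) by auto
  then have "real (2 * m + 1) * t = t + 2 * real k * pi \<or> real (2 * m + 1) * t = - t + 2 * real k * pi"
    by (auto simp: algebra_simps)
  then have "cos (real (2 * m + 1) * t) = cos t"
    unfolding cos_eq by (auto intro!: bexI[of _ "real k"])
  with t show ?L by simp
qed

text \<open>The two families of solutions have \<open>m - 1\<close> and \<open>m\<close> members,
  and they are disjoint because \<open>m\<close> and \<open>m + 1\<close> are coprime.\<close>

lemma card_cos_odd_mult_eq_cos:
  fixes m :: nat
  assumes "m > 0"
  shows "finite {t \<in> {0<..<pi}. cos (real (2 * m + 1) * t) = cos t}"
    and "card {t \<in> {0<..<pi}. cos (real (2 * m + 1) * t) = cos t} = 2 * m - 1"
proof -
  let ?A = "(\<lambda>k. real k * pi / real m) ` {1..<m}"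
  let ?B = "(\<lambda>k. real k * pi / real (m + 1)) ` {1..<m+1}"
  have eq: "{t \<in> {0<..<pi}. cos (real (2 * m + 1) * t) = cos t} = ?A \<union> ?B"
    using cos_odd_mult_eq_cos_iff[OF assms] by blast
  have "?A \<inter> ?B = {}"
  proof (rule ccontr)
    assume "?A \<inter> ?B \<noteq> {}"
    then obtain x where x: "x \<in> ?A" "x \<in> ?B" by blast
    obtain k where k: "k \<in> {1..<m}" "x = real k * pi / real m" using x(1) by (rule imageE)
    obtain j where j: "x = real j * pi / real (m + 1)" using x(2) by (rule imageE)
    have "real k * pi / real m = real j * pi / real (m + 1)"
      using k(2) j by simp
    then have "pi * (real k * real (m + 1)) = pi * (real j * real m)"
      using assms by (simp add: field_simps)
    then have "real k * real (m + 1) = real j * real m"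
      unfolding mult_cancel_left by simp
    then have "k * (m + 1) = j * m"
      by (metis of_nat_mult of_nat_eq_iff)
    then have "m dvd k * (m + 1)" by simp
    then have "m dvd k"
      by (metis coprime_dvd_mult_left_iff coprime_add_one_right)
    with k(1) show False by (auto dest: dvd_imp_le)
  qed
  moreover have "card ?A = m - 1" "card ?B = m"
    using assms by (subst card_image; auto simp: inj_on_def)+
  ultimately have "card (?A \<union> ?B) = 2 * m - 1"
    using assms by (subst card_Un_disjoint) auto
  then show "finite {t \<in> {0<..<pi}. cos (real (2 * m + 1) * t) = cos t}"
    "card {t \<in> {0<..<pi}. cos (real (2 * m + 1) * t) = cos t} = 2 * m - 1"
    unfolding eq by auto
qed

subsection \<open>A linearising coordinate\<close>

lemma DERIV_hesse_fun:
  assumes "c \<noteq> 0"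
  shows "(hesse_fun has_real_derivative (216 - c^3) / (3 * c^3)) (at c)"
proof -
  have "((\<lambda>c. - (108 + c^3)) has_real_derivative - (3 * c^2)) (at c)"
    by (rule derivative_eq_intros refl)+ simp
  moreover have "((\<lambda>c. 3 * c^2) has_real_derivative 6 * c) (at c)"
    by (rule derivative_eq_intros refl)+ simp
  moreover have "3 * c^2 \<noteq> 0" using assms by simp
  ultimately have "((\<lambda>c. - (108 + c^3) / (3 * c^2)) has_real_derivative
      (- (3 * c^2) * (3 * c^2) - - (108 + c^3) * (6 * c)) / (3 * c^2 * (3 * c^2))) (at c)"
    by (rule DERIV_divide)
  also have "(- (3 * c^2) * (3 * c^2) - - (108 + c^3) * (6 * c)) / (3 * c^2 * (3 * c^2)) =
      (216 - c^3) / (3 * c^3)"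
  proof (subst frac_eq_eq)
    show "(- (3 * c^2) * (3 * c^2) - - (108 + c^3) * (6 * c)) * (3 * c^3) =
        (216 - c^3) * (3 * c^2 * (3 * c^2))"
      by algebra
  qed (use assms in auto)
  finally show ?thesis
    by (simp add: hesse_fun_def[abs_def])
qed

text \<open>The square shows that \<open>hesse_fun\<close> exchanges the two sides of
  \<open>-3\<close>, except at the pole 0 and at the critical point 6, which lands on
  \<open>-3\<close>.\<close>

lemma hesse_fun_plus_3:
  assumes "c \<noteq> 0"
  shows "hesse_fun c + 3 = - (c + 3) * (c - 6)^2 / (3 * c^2)"
  using assms by (simp add: hesse_fun_def field_simps power2_eq_square power3_eq_cube)

lemma hesse_fun_gt:
  assumes "c < - 3"
  shows "hesse_fun c > - 3"
proof -
  have "0 < - (c + 3) * (c - 6)^2 / (3 * c^2)"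
    using assms by (intro divide_pos_pos mult_pos_pos) auto
  also have "\<dots> = hesse_fun c + 3"
    using assms by (intro hesse_fun_plus_3[symmetric]) auto
  finally show ?thesis by simp
qed

lemma hesse_fun_lt:
  assumes "c > - 3" "c \<noteq> 0" "c \<noteq> 6"
  shows "hesse_fun c < - 3"
proof -
  have "hesse_fun c + 3 = - (c + 3) * (c - 6)^2 / (3 * c^2)"
    using assms by (intro hesse_fun_plus_3) auto
  also have "\<dots> < 0"
    using assms by (intro divide_neg_pos mult_neg_pos) auto
  finally show ?thesis by simp
qed

text \<open>On the negative axis both terms of \<open>- c / 3 - 36 / c^2\<close> are strictly
  decreasing.\<close>

lemma hesse_fun_less:
  assumes "a < b" "b < 0"
  shows "hesse_fun b < hesse_fun a"
proof -
  have eq: "hesse_fun c = - c / 3 - 36 / c^2" if "c < 0" for c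
    using that by (simp add: hesse_fun_def field_simps power2_eq_square power3_eq_cube)
  have "b^2 < a^2"
    using assms power_strict_mono[of "- b" "- a" 2] by simp
  then have "36 / a^2 < 36 / b^2"
    using assms by (intro divide_strict_left_mono) auto
  then show ?thesis using assms by (simp add: eq)
qed

text \<open>Preimages become roots of a polynomial, to which the intermediate value theorem applies
  across the pole at 0.\<close>

lemma hesse_fun_eq_iff:
  "c \<noteq> 0 \<Longrightarrow> hesse_fun c = y \<longleftrightarrow> c^3 + 3 * y * c^2 + 108 = 0"
  by (auto simp: hesse_fun_def field_simps)

lemma hesse_fun_preimage_left:
  assumes "v > - 3"
  obtains u where "u < - 3" "hesse_fun u = v"
proof -
  \<comment> \<open>This gives \<open>a + 3 * v \<le> - 6\<close> and \<open>a^2 \<ge> 36\<close>,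
    so the cubic is at most \<open>- 216 + 108\<close> at \<open>a\<close>, while at
    \<open>-3\<close> it equals \<open>27 * (v + 3)\<close>.\<close>
  define a where "a = - 3 * \<bar>v\<bar> - 6"
  have "6^2 \<le> (- a)^2" by (rule power_mono) (auto simp: a_def)
  then have "36 \<le> a^2" by simp
  moreover have "a^2 * (a + 3 * v) \<le> a^2 * (- 6)"
    by (intro mult_left_mono) (auto simp: a_def)
  ultimately have "a^3 + 3 * v * a^2 + 108 \<le> 0"
    by (simp add: power2_eq_square power3_eq_cube algebra_simps)
  moreover have "0 \<le> (- 3)^3 + 3 * v * (- 3)^2 + 108" using assms by simp
  moreover have "a \<le> - 3" by (simp add: a_def)
  ultimately have "\<exists>u. a \<le> u \<and> u \<le> - 3 \<and> u^3 + 3 * v * u^2 + 108 = 0"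
    by (intro IVT') (auto intro!: continuous_intros)
  then obtain u where "u \<le> - 3" "u^3 + 3 * v * u^2 + 108 = 0" by blast
  moreover from this have "u \<noteq> - 3" using assms by auto
  ultimately show ?thesis using that[of u] by (simp add: hesse_fun_eq_iff)
qed

lemma hesse_fun_preimage_middle:
  assumes "y < - 3"
  obtains u where "0 < u" "u < 6" "hesse_fun u = y"
proof -
  \<comment> \<open>The cubic is 108 at 0 and \<open>108 * (y + 3)\<close>, hence negative, at
    6.\<close>
  have "\<exists>u\<ge>0. u \<le> 6 \<and> u^3 + 3 * y * u^2 + 108 = 0"
    by (rule IVT2') (use assms in \<open>auto intro!: continuous_intros\<close>)
  then obtain u where u: "0 \<le> u" "u \<le> 6" "u^3 + 3 * y * u^2 + 108 = 0" by blast
  then have "u \<noteq> 0" "u \<noteq> 6" using assms by auto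
  with u show ?thesis using that[of u] by (simp add: hesse_fun_eq_iff)
qed

text \<open>The squared factor is the derivative of \<open>hesse_fun\<close>, so the differential
  \<open>dx / sqrt \<bar>x^3 + 27\<bar>\<close> is scaled by \<open>sqrt 3\<close> in absolute
  value. The minus sign reflects the exchange of the two arcs.\<close>

lemma hesse_fun_cube_plus_27:
  assumes "c \<noteq> 0"
  shows "hesse_fun c ^ 3 + 27 = - (c^3 + 27) * ((216 - c^3) / (3 * c^3))^2 / 3"
proof -
  define u where "u = c^3"
  have "u \<noteq> 0" using assms by (simp add: u_def)
  have "(3 * c^2)^3 = 27 * u^2" by (simp add: u_def power_mult_distrib flip: power_mult)
  then have "hesse_fun c ^ 3 = (- (108 + u))^3 / (27 * u^2)"
    by (simp add: hesse_fun_def power_divide flip: u_def)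
  then have "hesse_fun c ^ 3 + 27 = ((- (108 + u))^3 + 27 * (27 * u^2)) / (27 * u^2)"
    using \<open>u \<noteq> 0\<close> by (simp add: add_divide_distrib)
  also have "(- (108 + u))^3 + 27 * (27 * u^2) = - (u + 27) * (216 - u)^2"
    by algebra
  also have "- (u + 27) * (216 - u)^2 / (27 * u^2) = - (u + 27) * ((216 - u) / (3 * u))^2 / 3"
    by (simp add: power_divide power_mult_distrib)
  finally show ?thesis by (simp only: u_def)
qed

text \<open>The density \<open>1 / sqrt \<bar>x\<^sup>3 + 27\<bar>\<close> comes from the invariant differential of the elliptic curve
  \<open>y\<^sup>2 = x\<^sup>3 + 27\<close>; \<open>hesse_fun\<close> is the action on \<open>x\<close>-coordinates of an endomorphism of degree \<open>3\<close>
  and therefore scales it by \<open>sqrt 3\<close> up to sign.\<close>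

lemma hesse_fun_density:
  fixes F :: "real \<Rightarrow> real"
  assumes F: "\<And>x. x < - 3 \<Longrightarrow> (F has_real_derivative 1 / sqrt (- (x^3 + 27))) (at x)"
    and x: "x < - 3" "hesse_fun x \<noteq> 0" "hesse_fun x \<noteq> 6"
  shows "((\<lambda>x. F (hesse_fun (hesse_fun x))) has_real_derivative
    (if 0 < hesse_fun x \<and> hesse_fun x < 6 then - 3 else 3) * (1 / sqrt (- (x^3 + 27)))) (at x)"
proof -
  define y where "y = hesse_fun x"
  \<comment> \<open>\<open>D\<close> is the derivative of the second iterate at \<open>x\<close>.
    Its square gives the scaling by 3, and its sign, governed by whether \<open>y\<close> lies
    between 0 and 6, gives the orientation.\<close>
  define D where "D = (216 - y^3) / (3 * y^3) * ((216 - x^3) / (3 * x^3))"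
  have y: "y > - 3" "y \<noteq> 0" "y \<noteq> 6" "hesse_fun y < - 3"
    using x hesse_fun_gt hesse_fun_lt by (auto simp: y_def)
  have "x^3 < 0" using x by simp
  have sgn_x: "(216 - x^3) / (3 * x^3) < 0"
    using \<open>x^3 < 0\<close> by (intro divide_pos_neg) linarith+
  have "216 - y^3 = (6 - y) * ((y + 3)^2 + 27)" by algebra
  moreover have "(y + 3)^2 + 27 > 0" by (intro add_nonneg_pos) auto
  ultimately have "0 < 216 - y^3 \<longleftrightarrow> 0 < 6 - y" "216 - y^3 < 0 \<longleftrightarrow> 6 - y < 0"
    by (simp_all add: zero_less_mult_iff mult_less_0_iff)
  then have y6: "y^3 < 216 \<longleftrightarrow> y < 6" "216 < y^3 \<longleftrightarrow> 6 < y"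
    by simp_all
  have "y^3 \<noteq> 216" using y y6 by auto
  then have "(216 - y^3) / (3 * y^3) \<noteq> 0" "0 < (216 - y^3) / (3 * y^3) \<longleftrightarrow> 0 < y \<and> y < 6"
    using y y6 by (auto simp: zero_less_divide_iff)
  with sgn_x have D: "D \<noteq> 0" "D < 0 \<longleftrightarrow> 0 < y \<and> y < 6"
    unfolding D_def mult_less_0_iff mult_eq_0_iff by auto
  have "hesse_fun y ^ 3 + 27 = (x^3 + 27) * (D / 3)^2"
  proof -
    define Y X where "Y = (216 - y^3) / (3 * y^3)" and "X = (216 - x^3) / (3 * x^3)"
    have "hesse_fun y ^ 3 + 27 = - (y^3 + 27) * Y^2 / 3"
      unfolding Y_def by (rule hesse_fun_cube_plus_27[OF y(2)])
    also have "y^3 + 27 = - (x^3 + 27) * X^2 / 3"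
      unfolding X_def y_def using x by (intro hesse_fun_cube_plus_27) auto
    also have "- (- t * X^2 / 3) * Y^2 / 3 = t * (Y * X / 3)^2" for t
      by (simp add: power_mult_distrib power_divide)
    also have "Y * X = D" by (simp add: D_def X_def Y_def)
    finally show ?thesis .
  qed
  then have "sqrt (- (hesse_fun y ^ 3 + 27)) = sqrt (- (x^3 + 27)) * (\<bar>D\<bar> / 3)"
    by (simp only: real_sqrt_mult real_sqrt_abs abs_divide abs_numeral flip: mult_minus_left)
  moreover have "1 / (s * (\<bar>D\<bar> / 3)) * D = (if 0 < y \<and> y < 6 then - 3 else 3) * (1 / s)" for s
    using D by (cases "D < 0") (auto simp: not_less)
  ultimately have eq: "1 / sqrt (- (hesse_fun y ^ 3 + 27)) * D =
      (if 0 < y \<and> y < 6 then - 3 else 3) * (1 / sqrt (- (x^3 + 27)))"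
    by (simp only:)
  have "(F has_real_derivative 1 / sqrt (- (hesse_fun y ^ 3 + 27))) (at (hesse_fun (hesse_fun x)))"
    using F[OF y(4)] by (simp add: y_def)
  moreover have "((\<lambda>x. hesse_fun (hesse_fun x)) has_real_derivative D) (at x)"
    unfolding D_def y_def
    by (rule DERIV_chain2; rule DERIV_hesse_fun) (use x in auto)
  ultimately have "((\<lambda>x. F (hesse_fun (hesse_fun x))) has_real_derivative
      1 / sqrt (- (hesse_fun y ^ 3 + 27)) * D) (at x)"
    by (rule DERIV_chain2)
  then show ?thesis unfolding eq by (simp add: y_def)
qed

lemma ex_strict_mono_antiderivative:
  obtains F :: "real \<Rightarrow> real"
  where "\<And>x. x < - 3 \<Longrightarrow> (F has_real_derivative 1 / sqrt (- (x^3 + 27))) (at x)"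
    and "\<And>x y. x < y \<Longrightarrow> y < - 3 \<Longrightarrow> F x < F y"
proof -
  have cube: "- (x^3 + 27) > 0" if "x < - 3" for x :: real
    using power_strict_mono[of 3 "- x" 3] that by simp
  have "\<exists>F :: real \<Rightarrow> real. \<forall>x. - \<infinity> < ereal x \<longrightarrow> ereal x < ereal (- 3) \<longrightarrow>
      (F has_vector_derivative 1 / sqrt (- (x^3 + 27))) (at x)"
    by (rule einterval_antiderivative) (auto intro!: continuous_intros dest: cube)
  then obtain F :: "real \<Rightarrow> real" where
    F: "\<And>x. x < - 3 \<Longrightarrow> (F has_real_derivative 1 / sqrt (- (x^3 + 27))) (at x)"
    by (auto simp: has_real_derivative_iff_has_vector_derivative)
  moreover have "F x < F y" if "x < y" "y < - 3" for x y
    using that(1)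
  proof (rule DERIV_pos_imp_increasing)
    fix z assume "x \<le> z" "z \<le> y"
    then show "\<exists>d. (F has_real_derivative d) (at z) \<and> d > 0"
      using F[of z] cube[of z] that by (intro exI[of _ "1 / sqrt (- (z^3 + 27))"]) auto
  qed
  ultimately show ?thesis using that by blast
qed

text \<open>Bounds on an open interval pass to its end points. They serve to pin down the additive
  constants of the two outer branches.\<close>

lemma affine_range_bounds:
  fixes a b k c :: real
  assumes "a < b" "\<And>v. a < v \<Longrightarrow> v < b \<Longrightarrow> 0 \<le> 3 * v + k \<and> 3 * v + k \<le> c"
  shows "0 \<le> 3 * a + k" "3 * b + k \<le> c"
  using dense_ge_bounded[of a b "- k / 3"] dense_le_bounded[of a b "(c - k) / 3"] assms
  by (force simp: field_simps)+

text \<open>On \<open>{..<-3}\<close> the second iterate has three monotone branches, separated by the points \<open>p < q\<close>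
  with images \<open>6\<close> and \<open>0\<close>. As it maps \<open>{p<..<q}\<close> onto \<open>{..<-3}\<close> and scales \<open>F\<close> by \<open>-3\<close> there,
  \<open>F\<close> is bounded. No estimate of an improper integral is needed.\<close>

lemma hesse_fun_coordinate:
  obtains \<phi> :: "real \<Rightarrow> real" where "bij_betw \<phi> {..<- 3} {0<..<pi}"
    and "\<And>x. x < - 3 \<Longrightarrow> hesse_fun x = 0 \<Longrightarrow> \<phi> x = 2 * pi / 3"
    and "\<And>x. x < - 3 \<Longrightarrow> hesse_fun x = 6 \<Longrightarrow> \<phi> x = pi / 3"
    and "\<And>x. x < - 3 \<Longrightarrow> hesse_fun x \<noteq> 0 \<Longrightarrow> hesse_fun x \<noteq> 6 \<Longrightarrow>
      cos (\<phi> (hesse_fun (hesse_fun x))) = cos (3 * \<phi> x)"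
proof -
  define g where "g = (\<lambda>x. hesse_fun (hesse_fun x))"
  obtain F :: "real \<Rightarrow> real" where
    F: "\<And>x. x < - 3 \<Longrightarrow> (F has_real_derivative 1 / sqrt (- (x^3 + 27))) (at x)" and
    F_less: "\<And>x y. x < y \<Longrightarrow> y < - 3 \<Longrightarrow> F x < F y"
    using ex_strict_mono_antiderivative by blast
  obtain p where p: "p < - 3" "hesse_fun p = 6" by (rule hesse_fun_preimage_left[of 6]) auto
  obtain q where q: "q < - 3" "hesse_fun q = 0" by (rule hesse_fun_preimage_left[of 0]) auto
  have less_iff: "hesse_fun y < hesse_fun x \<longleftrightarrow> x < y" if "x < - 3" "y < - 3" for x y
    using hesse_fun_less[of x y] hesse_fun_less[of y x] that
    by (cases x y rule: linorder_cases) auto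
  have F_less_iff: "F x < F y \<longleftrightarrow> x < y" if "x < - 3" "y < - 3" for x y
    using F_less[of x y] F_less[of y x] that by (cases x y rule: linorder_cases) auto
  have "p < q" using less_iff[OF p(1) q(1)] p q by simp
  have deriv: "((\<lambda>x. F (g x)) has_real_derivative
      (if p < x \<and> x < q then - 3 else 3) * (1 / sqrt (- (x^3 + 27)))) (at x)"
    if "x < - 3" "x \<noteq> p" "x \<noteq> q" for x
  proof -
    have "hesse_fun x \<noteq> 0" "hesse_fun x \<noteq> 6" "0 < hesse_fun x \<longleftrightarrow> x < q" "hesse_fun x < 6 \<longleftrightarrow> p < x"
      using less_iff[OF that(1) q(1)] less_iff[OF p(1) that(1)]
        less_iff[OF q(1) that(1)] less_iff[OF that(1) p(1)] that p q by auto
    then show ?thesis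
      using hesse_fun_density[OF F that(1)] unfolding g_def by (simp add: conj_commute)
  qed
  \<comment> \<open>On each branch the composite with \<open>g\<close> has derivative
    \<open>s\<close> times that of \<open>F\<close>, so \<open>F\<close> turns \<open>g\<close> into
    an affine map of slope \<open>s\<close>.\<close>
  have const: "\<exists>k. \<forall>x\<in>S. F (g x) - s * F x = k"
    if "convex S" "\<And>x. x \<in> S \<Longrightarrow> x < - 3 \<and> x \<noteq> p \<and> x \<noteq> q \<and> s = (if p < x \<and> x < q then - 3 else 3)"
    for S s
  proof (rule has_field_derivative_zero_constant[OF that(1)])
    fix x assume "x \<in> S"
    then have "((\<lambda>x. F (g x) - s * F x) has_real_derivative
        s * (1 / sqrt (- (x^3 + 27))) - s * (1 / sqrt (- (x^3 + 27)))) (at x)"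
      using that(2)[of x] deriv[of x] F[of x] by (intro DERIV_diff DERIV_cmult) auto
    then show "((\<lambda>x. F (g x) - s * F x) has_real_derivative 0) (at x within S)"
      by (simp add: has_field_derivative_at_within)
  qed
  have "\<exists>k. \<forall>x\<in>{..<p}. F (g x) - 3 * F x = k" by (rule const) (use \<open>p < q\<close> p q in auto)
  then obtain k1 where k1: "\<And>x. x < p \<Longrightarrow> F (g x) - 3 * F x = k1" by blast
  have "\<exists>k. \<forall>x\<in>{p<..<q}. F (g x) - - 3 * F x = k" by (rule const) (use p q in auto)
  then obtain k2 where k2: "\<And>x. p < x \<Longrightarrow> x < q \<Longrightarrow> F (g x) + 3 * F x = k2" by auto
  have "\<exists>k. \<forall>x\<in>{q<..<- 3}. F (g x) - 3 * F x = k" by (rule const) (use \<open>p < q\<close> p q in auto)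
  then obtain k3 where k3: "\<And>x. q < x \<Longrightarrow> x < - 3 \<Longrightarrow> F (g x) - 3 * F x = k3" by auto
  have g_less: "g x < - 3" if "x < - 3" "x \<noteq> p" "x \<noteq> q" for x
  proof -
    have "hesse_fun x \<noteq> 6" "hesse_fun x \<noteq> 0"
      using less_iff[OF that(1) q(1)] less_iff[OF p(1) that(1)]
        less_iff[OF q(1) that(1)] less_iff[OF that(1) p(1)] that p q by auto
    then show ?thesis
      using hesse_fun_gt[OF that(1)] hesse_fun_lt by (simp add: g_def)
  qed
  \<comment> \<open>These are the values of the affine map \<open>k2 - 3 * v\<close> at the ends
    \<open>F q\<close> and \<open>F p\<close> of the middle branch; they turn out to bound the range
    of \<open>F\<close>.\<close>
  define L U where "L = k2 - 3 * F q" and "U = k2 - 3 * F p"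
  have "F p < F q" using F_less \<open>p < q\<close> q by simp
  then have "L < U" by (simp add: L_def U_def)
  have F_bounds: "L < F y \<and> F y < U" if y: "y < - 3" for y
  proof -
    \<comment> \<open>Lifting \<open>y\<close> through \<open>{0<..<6}\<close> and then to the left
      arc produces a preimage under \<open>g\<close> in the middle branch.\<close>
    obtain u where u: "0 < u" "u < 6" "hesse_fun u = y" using hesse_fun_preimage_middle[OF y] .
    obtain x where x: "x < - 3" "hesse_fun x = u" using hesse_fun_preimage_left[of u] u by auto
    have "p < x" "x < q" using less_iff[OF p(1) x(1)] less_iff[OF x(1) q(1)] u x p q by auto
    then have "F p < F x" "F x < F q" "F y = k2 - 3 * F x"
      using k2[of x] F_less x q u by (auto simp: g_def)
    then show ?thesis by (simp add: L_def U_def)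
  qed
  have F_surj: "\<exists>y. y < - 3 \<and> F y = z" if "L < z" "z < U" for z
  proof -
    have "\<exists>x\<ge>p. x \<le> q \<and> F x = (k2 - z) / 3"
    proof (rule IVT')
      show "continuous_on {p..q} F"
        using q by (intro continuous_at_imp_continuous_on ballI DERIV_isCont[OF F]) simp
    qed (use that \<open>p < q\<close> in \<open>auto simp: L_def U_def\<close>)
    then obtain x where x: "p \<le> x" "x \<le> q" "F x = (k2 - z) / 3" by blast
    with that have "p < x" "x < q" by (auto simp: L_def U_def order_less_le)
    then have "g x < - 3" "F (g x) + 3 * F x = k2" using k2[of x] g_less[of x] q by auto
    moreover have "3 * F x = k2 - z" using x(3) by simp
    ultimately have "g x < - 3" "F (g x) = z" by simp_all
    then show ?thesis by blast
  qed
  define \<phi> where "\<phi> = (\<lambda>x. pi / (U - L) * (F x - L))"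
  define l where "l = pi / (U - L)"
  have "l > 0" using \<open>L < U\<close> by (simp add: l_def)
  have l: "l * (U - L) = pi" using \<open>L < U\<close> by (simp add: l_def)
  have \<phi>: "\<phi> x = l * (F x - L)" for x by (simp add: \<phi>_def l_def)
  have \<phi>_less_iff: "\<phi> x < \<phi> y \<longleftrightarrow> x < y" if "x < - 3" "y < - 3" for x y
    using F_less_iff[OF that] \<open>l > 0\<close> by (simp add: \<phi>)
  have \<phi>_bounds: "0 < \<phi> x \<and> \<phi> x < pi" if "x < - 3" for x
    using F_bounds[OF that] \<open>l > 0\<close> by (simp add: \<phi> flip: l)
  have \<phi>_surj: "\<exists>y. y < - 3 \<and> \<phi> y = t" if "0 < t" "t < pi" for t
  proof -
    have "L < L + t / l" "L + t / l < U"
      using that \<open>l > 0\<close> by (simp_all add: field_simps flip: l)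
    then obtain y where "y < - 3" "F y = L + t / l" using F_surj by blast
    then show ?thesis using \<open>l > 0\<close> by (auto simp: \<phi>)
  qed
  have "inj_on \<phi> {..<- 3}"
  proof (rule linorder_inj_onI)
    fix x y :: real assume "x < y" "x \<in> {..<- 3}" "y \<in> {..<- 3}"
    then show "\<phi> x \<noteq> \<phi> y" using \<phi>_less_iff[of x y] by simp
  qed auto
  then have bij: "bij_betw \<phi> {..<- 3} {0<..<pi}"
    using \<phi>_bounds \<phi>_surj by (fastforce simp: bij_betw_def)
  define c1 c3 where "c1 = l * (k1 + 2 * L)" and "c3 = l * (k3 + 2 * L)"
  have \<phi>1: "\<phi> (g x) = 3 * \<phi> x + c1" if "x < p" for x
  proof -
    have eq: "F (g x) = 3 * F x + k1" using k1[OF that] by linarith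
    show ?thesis unfolding \<phi> eq c1_def by (simp add: algebra_simps)
  qed
  have \<phi>2: "\<phi> (g x) = 3 * \<phi> q - 3 * \<phi> x" if "p < x" "x < q" for x
  proof -
    have eq: "F (g x) = k2 - 3 * F x" using k2[OF that] by linarith
    show ?thesis unfolding \<phi> eq L_def by (simp add: algebra_simps)
  qed
  have \<phi>3: "\<phi> (g x) = 3 * \<phi> x + c3" if "q < x" "x < - 3" for x
  proof -
    have eq: "F (g x) = 3 * F x + k3" using k3[OF that] by linarith
    show ?thesis unfolding \<phi> eq c3_def by (simp add: algebra_simps)
  qed
  \<comment> \<open>The middle branch stretches its interval by 3 onto the whole range, whose length
    in the new coordinate is \<open>pi\<close>.\<close>
  have pq: "\<phi> q = \<phi> p + pi / 3"
  proof -
    have "3 * (l * (F q - F p)) = pi"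
      unfolding l[symmetric] L_def U_def by (simp add: algebra_simps)
    moreover have "\<phi> q - \<phi> p = l * (F q - F p)" by (simp add: \<phi> algebra_simps)
    ultimately show ?thesis by linarith
  qed
  have "0 \<le> 3 * v + c1 \<and> 3 * v + c1 \<le> pi" if v: "0 < v" "v < \<phi> p" for v
  proof -
    obtain x where x: "x < - 3" "\<phi> x = v" using \<phi>_surj[of v] \<phi>_bounds[OF p(1)] v by auto
    then have "x < p" using \<phi>_less_iff[OF x(1) p(1)] v by simp
    then show ?thesis
      using \<phi>_bounds[OF g_less[of x]] \<phi>1 x \<open>p < q\<close> by auto
  qed
  note bounds1 = affine_range_bounds[OF conjunct1[OF \<phi>_bounds[OF p(1)]] this]
  have "0 \<le> 3 * v + c3 \<and> 3 * v + c3 \<le> pi" if v: "\<phi> q < v" "v < pi" for v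
  proof -
    obtain x where x: "x < - 3" "\<phi> x = v" using \<phi>_surj[of v] \<phi>_bounds[OF q(1)] v by auto
    then have "q < x" using \<phi>_less_iff[OF q(1) x(1)] v by simp
    then show ?thesis
      using \<phi>_bounds[OF g_less[of x]] \<phi>3 x \<open>p < q\<close> by auto
  qed
  note bounds3 = affine_range_bounds[OF conjunct2[OF \<phi>_bounds[OF q(1)]] this]
  \<comment> \<open>The bounds at the end points 0 and \<open>pi\<close> give
    \<open>c1 \<ge> 0\<close> and \<open>c3 \<le> - 2 * pi\<close>. Those at \<open>p\<close> and
    \<open>q\<close> then give \<open>\<phi> p \<le> pi / 3\<close> and
    \<open>\<phi> q \<ge> 2 * pi / 3\<close>; since these values differ by \<open>pi / 3\<close>,
    equality holds throughout.\<close>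
  have vals: "c1 = 0" "\<phi> p = pi / 3" "c3 = - 2 * pi" "\<phi> q = 2 * pi / 3"
    using pq bounds1 bounds3 by linarith+
  have inj_h: "x = y" if "x < - 3" "y < - 3" "hesse_fun x = hesse_fun y" for x y
    using less_iff[of x y] less_iff[of y x] that by auto
  show ?thesis
  proof (rule that[OF bij])
    fix x :: real assume x: "x < - 3"
    show "hesse_fun x = 0 \<Longrightarrow> \<phi> x = 2 * pi / 3" "hesse_fun x = 6 \<Longrightarrow> \<phi> x = pi / 3"
      using inj_h[OF x q(1)] inj_h[OF x p(1)] p q vals by auto
    assume "hesse_fun x \<noteq> 0" "hesse_fun x \<noteq> 6"
    then consider "x < p" | "p < x" "x < q" | "q < x"
      using p q by (metis linorder_neqE_linordered_idom)
    then show "cos (\<phi> (hesse_fun (hesse_fun x))) = cos (3 * \<phi> x)"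
    proof cases
      case 1 then show ?thesis using \<phi>1 vals by (simp add: g_def)
    next
      case 2 then show ?thesis using \<phi>2 vals cos_periodic[of "- 3 * \<phi> x"] by (simp add: g_def add.commute)
    next
      case 3 then show ?thesis using \<phi>3 vals x cos_periodic[of "3 * \<phi> x - 2 * pi"] by (simp add: g_def)
    qed
  qed
qed

subsection \<open>Counting cycles\<close>

lemma hesse_map_simps:
  "hesse_map None = None" "hesse_map (Some 0) = None"
  "c \<noteq> 0 \<Longrightarrow> hesse_map (Some c) = Some (hesse_fun c)"
  by (simp_all add: hesse_map_def)

lemma hesse_fun_fixed: "hesse_fun (- 3) = - 3" "hesse_fun 6 = - 3"
  by (simp_all add: hesse_fun_def)

abbreviation left_arc :: "real option set" where
  "left_arc \<equiv> Some ` {..<- 3}"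

text \<open>The end points are adjoined to obtain a set invariant under the second iterate:
  preimages of 0 and 6 in the open arc are sent to \<open>None\<close> and
  \<open>Some (- 3)\<close>.\<close>

abbreviation closed_left_arc :: "real option set" where
  "closed_left_arc \<equiv> left_arc \<union> {None, Some (- 3)}"

lemma hesse_map_left_arc:
  assumes "x \<in> left_arc"
  shows "hesse_map x \<in> Some ` {- 3<..}"
  using assms hesse_fun_gt by (auto simp: hesse_map_simps)

lemma hesse_map_right_arc:
  assumes "x \<in> Some ` {- 3<..}"
  shows "hesse_map x \<in> closed_left_arc"
proof -
  obtain c where c: "x = Some c" "c > - 3" using assms by auto
  consider "c = 0" | "c = 6" | "c \<noteq> 0" "c \<noteq> 6" by blast
  then show ?thesis
    by cases (use c hesse_fun_lt[of c] in \<open>auto simp: hesse_map_simps hesse_fun_fixed\<close>)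
qed

lemma hesse_map_closed_left_arc:
  "x \<in> closed_left_arc \<Longrightarrow> hesse_map (hesse_map x) \<in> closed_left_arc"
  using hesse_map_right_arc[OF hesse_map_left_arc[of x]]
  by (auto simp: hesse_map_simps hesse_fun_fixed)

lemma funpow_two_mult: "((f ^^ 2) ^^ k) x = (f ^^ (2 * k)) x" for f :: "'a \<Rightarrow> 'a"
  by (simp add: funpow_mult)

lemma funpow_hesse_map_closed_left_arc:
  assumes "x \<in> closed_left_arc"
  shows "((hesse_map ^^ 2) ^^ k) x \<in> closed_left_arc"
proof (induction k)
  case (Suc k)
  then show ?case
    using hesse_map_closed_left_arc by (simp add: numeral_2_eq_2)
qed (use assms in simp)

text \<open>The relation has to hold at the end points as well, since iterates may reach them; there
  it says \<open>cos 0 = cos 0\<close> and \<open>cos pi = cos (3 * pi)\<close>.\<close>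

lemma hesse_map_coordinate:
  obtains \<psi> :: "real option \<Rightarrow> real" where "bij_betw \<psi> left_arc {0<..<pi}"
    and "inj_on \<psi> closed_left_arc" and "\<psi> ` closed_left_arc \<subseteq> {0..pi}"
    and "\<And>x. x \<in> closed_left_arc \<Longrightarrow> cos (\<psi> ((hesse_map ^^ 2) x)) = cos (3 * \<psi> x)"
proof -
  obtain \<phi> :: "real \<Rightarrow> real" where \<phi>: "bij_betw \<phi> {..<- 3} {0<..<pi}"
    "\<And>x. x < - 3 \<Longrightarrow> hesse_fun x = 0 \<Longrightarrow> \<phi> x = 2 * pi / 3"
    "\<And>x. x < - 3 \<Longrightarrow> hesse_fun x = 6 \<Longrightarrow> \<phi> x = pi / 3"
    "\<And>x. x < - 3 \<Longrightarrow> hesse_fun x \<noteq> 0 \<Longrightarrow> hesse_fun x \<noteq> 6 \<Longrightarrow>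
      cos (\<phi> (hesse_fun (hesse_fun x))) = cos (3 * \<phi> x)"
    using hesse_fun_coordinate by blast
  \<comment> \<open>The values 0 at infinity and \<open>pi\<close> at \<open>-3\<close> agree with
    the cosines 1 and -1 needed at the points of coordinate \<open>2 * pi / 3\<close> and
    \<open>pi / 3\<close>.\<close>
  define \<psi> where "\<psi> = (\<lambda>x. case x of None \<Rightarrow> 0 | Some c \<Rightarrow> if c < - 3 then \<phi> c else pi)"
  have \<psi>: "\<psi> None = 0" "\<psi> (Some (- 3)) = pi" "\<And>c. c < - 3 \<Longrightarrow> \<psi> (Some c) = \<phi> c"
    by (simp_all add: \<psi>_def)
  have range: "0 < \<phi> c \<and> \<phi> c < pi" if "c < - 3" for c
    using \<phi>(1) that by (auto simp: bij_betw_def)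
  have inj: "\<phi> c = \<phi> d \<longleftrightarrow> c = d" if "c < - 3" "d < - 3" for c d
    using \<phi>(1) that by (auto simp: bij_betw_def inj_on_def)
  have "bij_betw (\<psi> \<circ> Some) {..<- 3} {0<..<pi}"
    using \<phi>(1) by (rule bij_betw_cong[THEN iffD1, rotated]) (simp add: \<psi>)
  then have "bij_betw \<psi> left_arc {0<..<pi}"
    by (simp add: bij_betw_def inj_on_def image_comp)
  moreover have "inj_on \<psi> closed_left_arc"
    unfolding inj_on_def using range by (fastforce simp: \<psi> inj)
  moreover have "\<psi> ` closed_left_arc \<subseteq> {0..pi}"
    using range by (auto simp: \<psi> less_imp_le)
  moreover have "cos (\<psi> ((hesse_map ^^ 2) x)) = cos (3 * \<psi> x)" if x: "x \<in> closed_left_arc" for x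
  proof (cases "x \<in> left_arc")
    case True
    then obtain c where c: "x = Some c" "c < - 3" by auto
    consider "hesse_fun c = 0" | "hesse_fun c = 6" | "hesse_fun c \<noteq> 0" "hesse_fun c \<noteq> 6"
      by blast
    then show ?thesis
    proof cases
      case 1
      then have eq: "3 * \<phi> c = 2 * pi" using \<phi>(2)[OF c(2)] by simp
      have "cos (3 * \<phi> c) = 1" unfolding eq by simp
      with 1 c show ?thesis
        by (simp add: numeral_2_eq_2 hesse_map_simps \<psi>)
    next
      case 2
      then have eq: "3 * \<phi> c = pi" using \<phi>(3)[OF c(2)] by simp
      have "cos (3 * \<phi> c) = - 1" unfolding eq by simp
      with 2 c show ?thesis
        by (simp add: numeral_2_eq_2 hesse_map_simps hesse_fun_fixed \<psi>)
    next
      case 3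
      then show ?thesis
        using \<phi>(4)[OF c(2)] c hesse_fun_lt[OF hesse_fun_gt]
        by (simp add: numeral_2_eq_2 hesse_map_simps \<psi>)
    qed
  next
    case False
    have "cos (3 * pi) = cos (pi + 2 * pi)" by simp
    then have "cos (3 * pi) = - 1" unfolding cos_periodic by simp
    with False x show ?thesis
      by (auto simp: numeral_2_eq_2 hesse_map_simps hesse_fun_fixed \<psi>)
  qed
  ultimately show ?thesis using that by blast
qed

text \<open>\<open>cos (3 * x)\<close> is a polynomial in \<open>cos x\<close>, so a relation known
  only between cosines can be iterated.\<close>

lemma cos_triple_cong: "cos x = cos y \<Longrightarrow> cos (3 * x) = cos (3 * y)" for x y :: real
  by (simp add: cos_treble_cos)

text \<open>As \<open>cos\<close> is injective on \<open>{0..pi}\<close>, the fixed points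
  correspond to the solutions of \<open>cos (3 ^ d * t) = cos t\<close>. Writing
  \<open>3 ^ d = 2 * m + 1\<close> turns their number \<open>2 * m - 1\<close> into
  \<open>3 ^ d - 2\<close>.\<close>

lemma card_periodic_left_arc:
  assumes "d > 0"
  shows "finite {x \<in> left_arc. ((hesse_map ^^ 2) ^^ d) x = x}"
    and "real (card {x \<in> left_arc. ((hesse_map ^^ 2) ^^ d) x = x}) = 3 ^ d - 2"
proof -
  obtain \<psi> :: "real option \<Rightarrow> real" where \<psi>: "bij_betw \<psi> left_arc {0<..<pi}"
    "inj_on \<psi> closed_left_arc" "\<psi> ` closed_left_arc \<subseteq> {0..pi}"
    and cos_\<psi>: "\<And>x. x \<in> closed_left_arc \<Longrightarrow> cos (\<psi> ((hesse_map ^^ 2) x)) = cos (3 * \<psi> x)"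
    using hesse_map_coordinate by blast
  have cos_pow: "cos (\<psi> (((hesse_map ^^ 2) ^^ n) x)) = cos (3 ^ n * \<psi> x)"
    if x: "x \<in> closed_left_arc" for x n
  proof (induction n)
    case (Suc n)
    have "cos (\<psi> (((hesse_map ^^ 2) ^^ Suc n) x)) = cos (3 * \<psi> (((hesse_map ^^ 2) ^^ n) x))"
      using cos_\<psi>[OF funpow_hesse_map_closed_left_arc[OF x]] by simp
    also have "\<dots> = cos (3 * (3 ^ n * \<psi> x))"
      by (rule cos_triple_cong[OF Suc])
    finally show ?case by (simp add: mult.assoc)
  qed simp
  have range: "\<psi> x \<in> {0..pi}" if "x \<in> closed_left_arc" for x
    using \<psi>(3) that by (rule subsetD[OF _ imageI])
  have iff: "((hesse_map ^^ 2) ^^ d) x = x \<longleftrightarrow> cos (3 ^ d * \<psi> x) = cos (\<psi> x)"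
    if x: "x \<in> closed_left_arc" for x
  proof -
    let ?y = "((hesse_map ^^ 2) ^^ d) x"
    have y: "?y \<in> closed_left_arc" by (rule funpow_hesse_map_closed_left_arc[OF x])
    have "?y = x \<longleftrightarrow> \<psi> ?y = \<psi> x"
      using inj_on_eq_iff[OF \<psi>(2) y x] by simp
    also have "\<dots> \<longleftrightarrow> cos (\<psi> ?y) = cos (\<psi> x)"
      using range[OF x] range[OF y] cos_inj_pi[of "\<psi> ?y" "\<psi> x"] by (metis atLeastAtMost_iff)
    finally show ?thesis by (simp only: cos_pow[OF x])
  qed
  have "odd (3 ^ d :: nat)" by simp
  then obtain m :: nat where m: "3 ^ d = 2 * m + 1" by (rule oddE)
  have "3 ^ 1 \<le> (3 ^ d :: nat)" using assms by (intro power_increasing) auto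
  then have "m > 0" using m by simp
  have pow: "(3 :: real) ^ d = real (2 * m + 1)"
    unfolding m[symmetric] by simp
  have "\<psi> ` {x \<in> left_arc. ((hesse_map ^^ 2) ^^ d) x = x} =
      \<psi> ` {x \<in> left_arc. cos (3 ^ d * \<psi> x) = cos (\<psi> x)}"
    using iff by (intro arg_cong[of _ _ "\<lambda>S. \<psi> ` S"] Collect_cong) blast
  also have "\<dots> = {t \<in> \<psi> ` left_arc. cos (3 ^ d * t) = cos t}" by blast
  also have "\<psi> ` left_arc = {0<..<pi}" using \<psi>(1) by (simp add: bij_betw_def)
  finally have img: "\<psi> ` {x \<in> left_arc. ((hesse_map ^^ 2) ^^ d) x = x} =
      {t \<in> {0<..<pi}. cos (real (2 * m + 1) * t) = cos t}"
    unfolding pow .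
  have inj: "inj_on \<psi> {x \<in> left_arc. ((hesse_map ^^ 2) ^^ d) x = x}"
    using \<psi>(1) by (auto simp: bij_betw_def intro: inj_on_subset)
  show "finite {x \<in> left_arc. ((hesse_map ^^ 2) ^^ d) x = x}"
    using card_cos_odd_mult_eq_cos(1)[OF \<open>m > 0\<close>] finite_image_iff[OF inj] unfolding img by blast
  have "card {x \<in> left_arc. ((hesse_map ^^ 2) ^^ d) x = x} = 2 * m - 1"
    using card_cos_odd_mult_eq_cos(2)[OF \<open>m > 0\<close>] card_image[OF inj] unfolding img by simp
  then show "real (card {x \<in> left_arc. ((hesse_map ^^ 2) ^^ d) x = x}) = 3 ^ d - 2"
    unfolding pow using \<open>m > 0\<close> by (simp add: of_nat_diff)
qed

lemma card_minimal_period_left_arc: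
  assumes "r > 0"
  shows "real (card {x \<in> left_arc. minimal_period (hesse_map ^^ 2) x r}) =
    (\<Sum>d | d dvd r. real_of_int (moebius_mu (r div d)) * (3 ^ d - 2))"
proof (rule moebius_inversion[OF assms])
  fix d assume "d dvd r"
  then have "d > 0" using assms dvd_pos_nat by blast
  then show "3 ^ d - 2 =
      (\<Sum>e | e dvd d. real (card {x \<in> left_arc. minimal_period (hesse_map ^^ 2) x e}))"
    using card_periodic_points[OF \<open>d > 0\<close> card_periodic_left_arc(1)]
      card_periodic_left_arc(2)[OF \<open>d > 0\<close>]
    by (simp flip: of_nat_sum)
qed

text \<open>An odd iterate sends the left arc into the right arc or to a fixed point, so every
  return time is even.\<close>

lemma minimal_period_hesse_map_left_arc_iff:
  assumes x: "x \<in> left_arc" and "r > 0"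
  shows "minimal_period hesse_map x (2 * r) \<longleftrightarrow> minimal_period (hesse_map ^^ 2) x r"
proof -
  have even: "even m" if "(hesse_map ^^ m) x = x" for m
  proof (rule ccontr)
    assume "odd m"
    then obtain k where "m = Suc (2 * k)" by (auto elim: oddE)
    then have "x = hesse_map (((hesse_map ^^ 2) ^^ k) x)"
      using that by (simp add: funpow_two_mult)
    moreover have "((hesse_map ^^ 2) ^^ k) x \<in> closed_left_arc"
      using x by (intro funpow_hesse_map_closed_left_arc) auto
    ultimately have "x \<in> Some ` {- 3<..} \<union> {None, Some (- 3)}"
      using hesse_map_left_arc by (fastforce simp: hesse_map_simps hesse_fun_fixed)
    then show False using x by auto
  qed
  have "(\<forall>m. (hesse_map ^^ m) x = x \<longleftrightarrow> 2 * r dvd m) \<longleftrightarrow>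
      (\<forall>k. (hesse_map ^^ (2 * k)) x = x \<longleftrightarrow> 2 * r dvd 2 * k)"
    using even by (metis dvd_mult_left evenE)
  then show ?thesis
    using \<open>r > 0\<close> by (simp add: minimal_period_iff funpow_two_mult)
qed

text \<open>A cycle of even length alternates between the arcs, and \<open>hesse_map\<close> carries
  its left half bijectively onto its right half.\<close>

lemma card_minimal_period_hesse_map:
  assumes "r > 0"
  shows "finite {x. minimal_period hesse_map x (2 * r)}"
    and "card {x. minimal_period hesse_map x (2 * r)} =
      2 * card {x \<in> left_arc. minimal_period (hesse_map ^^ 2) x r}"
proof -
  let ?P = "{x. minimal_period hesse_map x (2 * r)}"
  let ?A = "{x \<in> left_arc. minimal_period (hesse_map ^^ 2) x r}"
  have A: "?A = {x \<in> left_arc. x \<in> ?P}"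
    using minimal_period_hesse_map_left_arc_iff assms by blast
  have step: "hesse_map x \<in> ?P" if "x \<in> ?P" for x
    using minimal_period_shift[of hesse_map x "2 * r" 1] that by simp
  have not_fixed: "x \<noteq> None" "x \<noteq> Some (- 3)" if "x \<in> ?P" for x
  proof -
    have "\<forall>m. 0 < m \<and> m < 2 * r \<longrightarrow> (hesse_map ^^ m) x \<noteq> x"
      using that by (simp add: minimal_period_def)
    then have "hesse_map x \<noteq> x"
      by (elim allE[of _ 1]) (use assms in auto)
    then show "x \<noteq> None" "x \<noteq> Some (- 3)"
      by (intro notI; simp add: hesse_map_simps hesse_fun_fixed)+
  qed
  have arcs: "x \<in> left_arc \<or> x \<in> Some ` {- 3<..}" if "x \<in> ?P" for x
    using not_fixed[OF that] by (cases x) (auto simp: image_iff)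
  have pred: "hesse_map ((hesse_map ^^ (2 * r - 1)) x) = x" if "x \<in> ?P" for x
  proof -
    have "hesse_map ((hesse_map ^^ (2 * r - 1)) x) = (hesse_map ^^ Suc (2 * r - 1)) x"
      by (simp only: funpow.simps comp_apply)
    also have "Suc (2 * r - 1) = 2 * r" using assms by simp
    also have "(hesse_map ^^ (2 * r)) x = x" using that by (simp add: minimal_period_def)
    finally show ?thesis .
  qed
  have P: "?P = ?A \<union> hesse_map ` ?A"
  proof (intro equalityI subsetI)
    fix x assume x: "x \<in> ?P"
    let ?z = "(hesse_map ^^ (2 * r - 1)) x"
    have z: "?z \<in> ?P"
      using x unfolding mem_Collect_eq by (rule minimal_period_shift)
    show "x \<in> ?A \<union> hesse_map ` ?A"
    proof (cases "x \<in> left_arc")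
      case True
      then show ?thesis using A x by blast
    next
      case False
      \<comment> \<open>\<open>?z\<close> is the predecessor of \<open>x\<close> in its cycle. The
        right arc maps into \<open>closed_left_arc\<close>, so \<open>?z\<close> must lie on the
        left.\<close>
      then have "hesse_map ?z \<notin> closed_left_arc"
        using pred[OF x] not_fixed[OF x] by simp
      then have "?z \<in> left_arc"
        using arcs[OF z] hesse_map_right_arc by blast
      then have "?z \<in> ?A" using A z by blast
      then have "hesse_map ?z \<in> hesse_map ` ?A" by (rule imageI)
      then show ?thesis using pred[OF x] by simp
    qed
  next
    fix x assume "x \<in> ?A \<union> hesse_map ` ?A"
    then show "x \<in> ?P" using A step by blast
  qed
  have fin: "finite ?A"
    using card_periodic_left_arc(1)[OF assms] by (rule rev_finite_subset) (auto simp: minimal_period_def)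
  then show "finite ?P" unfolding P by simp
  have "inj_on hesse_map ?A"
  proof (rule inj_onI)
    fix x y assume xy: "x \<in> ?A" "y \<in> ?A" "hesse_map x = hesse_map y"
    then have "x \<in> ?P" "y \<in> ?P" using A by blast+
    \<comment> \<open>On the cycles in question \<open>2 * r - 1\<close> further steps undo
      \<open>hesse_map\<close>, although the map is three-to-one on the right arc.\<close>
    then show "x = y"
      using pred[of x] pred[of y] xy(3) by (simp add: funpow_swap1[of hesse_map])
  qed
  moreover have "?A \<inter> hesse_map ` ?A = {}"
    using hesse_map_left_arc by fastforce
  ultimately show "card ?P = 2 * card ?A"
    unfolding P using fin by (simp add: card_Un_disjoint card_image)
qed

text \<open>Loops start at real parameters, whereas \<open>hesse_map\<close> also acts on
  \<open>None\<close>. That point is fixed, so it contributes no cycle of length above 1.\<close>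

lemma hesse_loops_eq:
  assumes "n > 1"
  shows "hesse_loops n =
    image pencil_curve ` {(\<lambda>k. (hesse_map ^^ k) x) ` {..<n} | x. minimal_period hesse_map x n}"
proof -
  have None: "\<not> minimal_period hesse_map None n"
    using assms by (auto simp: minimal_period_def hesse_map_simps intro!: exI[of _ 1])
  have len: "has_loop_length c n \<longleftrightarrow> minimal_period hesse_map (Some c) n" for c
    by (simp add: has_loop_length_iff minimal_period_def)
  have img: "(\<lambda>k. hesse_iterate k (pencil_form c)) ` {..<n} =
      pencil_curve ` (\<lambda>k. (hesse_map ^^ k) (Some c)) ` {..<n}" for c
    by (simp add: hesse_iterate_pencil_form image_image)
  show ?thesis
  proof (intro equalityI subsetI)
    fix l assume "l \<in> hesse_loops n"
    then show "l \<in> image pencil_curve `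
        {(\<lambda>k. (hesse_map ^^ k) x) ` {..<n} | x. minimal_period hesse_map x n}"
      unfolding hesse_loops_def img len by blast
  next
    fix l assume "l \<in> image pencil_curve `
        {(\<lambda>k. (hesse_map ^^ k) x) ` {..<n} | x. minimal_period hesse_map x n}"
    then obtain x where x: "minimal_period hesse_map x n"
      "l = pencil_curve ` (\<lambda>k. (hesse_map ^^ k) x) ` {..<n}" by blast
    then obtain c where "x = Some c" using None by (cases x) auto
    with x show "l \<in> hesse_loops n"
      unfolding hesse_loops_def img len by blast
  qed
qed

theorem theorem22:
  fixes r :: nat
  assumes "r \<ge> 1"
  shows "finite (hesse_loops (2 * r)) \<and>
    real (card (hesse_loops (2 * r))) =
      1 / (2 * real r) *
        (\<Sum>d | d dvd r. real_of_int (moebius_mu (r div d)) * (2 * 3 ^ d - 4))"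
proof -
  have "r > 0" "2 * r > 0" "2 * r > 1" using assms by auto
  let ?C = "{(\<lambda>k. (hesse_map ^^ k) x) ` {..<2 * r} | x. minimal_period hesse_map x (2 * r)}"
  note eq = hesse_loops_eq[OF \<open>2 * r > 1\<close>]
  note cycles = card_cycles[OF card_minimal_period_hesse_map(1)[OF \<open>r > 0\<close>] \<open>2 * r > 0\<close>]
  \<comment> \<open>Different cycles of parameters give different sets of curves, so loops may be
    counted as cycles of \<open>hesse_map\<close>.\<close>
  have "inj_on (image pencil_curve) ?C"
    by (intro inj_on_image inj_on_subset[OF inj_pencil_curve] subset_UNIV)
  then have "card (hesse_loops (2 * r)) = card ?C"
    unfolding eq by (rule card_image)
  then have "2 * r * card (hesse_loops (2 * r)) =
      2 * card {x \<in> left_arc. minimal_period (hesse_map ^^ 2) x r}"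
    using cycles(2) card_minimal_period_hesse_map(2)[OF \<open>r > 0\<close>] by simp
  then have "real (2 * r * card (hesse_loops (2 * r))) =
      real (2 * card {x \<in> left_arc. minimal_period (hesse_map ^^ 2) x r})"
    by (simp only:)
  also have "\<dots> = 2 * real (card {x \<in> left_arc. minimal_period (hesse_map ^^ 2) x r})"
    by simp
  \<comment> \<open>The factor 2 for the two arcs turns \<open>3 ^ d - 2\<close> into
    \<open>2 * 3 ^ d - 4\<close>.\<close>
  also have "\<dots> = (\<Sum>d | d dvd r. real_of_int (moebius_mu (r div d)) * (2 * 3 ^ d - 4))"
    unfolding card_minimal_period_left_arc[OF \<open>r > 0\<close>] sum_distrib_left
    by (intro sum.cong) (simp_all add: algebra_simps)
  finally have "real (card (hesse_loops (2 * r))) =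
      1 / (2 * real r) * (\<Sum>d | d dvd r. real_of_int (moebius_mu (r div d)) * (2 * 3 ^ d - 4))"
    using assms by (simp add: field_simps)
  then show ?thesis
    using cycles(1) unfolding eq by simp
qed

end
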